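(* Let $k$ be a field of characteristic different from $2$. Let $G=\mathbb{Z}_2\times\mathbb{Z}_2=\{e,x,y,z\}$ with identity $e$ and $z=xy$, and let $F:G\times G\to k^*$ be the 2-cochain given by the symmetric Hadamard matrix $$H=\begin{pmatrix}1&1&1&1\\1&1&-1&-1\\1&-1&1&-1\\1&-1&-1&1\end{pmatrix},$$ with rows and columns indexed by $e,x,y,z$ in this order, i.e. $F(a,b)=H_{a,b}$. Then the algebra $k_FG$ is nonsimple, associative and commutative.
   Context: $k_FG$ is the $k$-vector space with basis $G$ and bilinear product $a\cdot b=F(a,b)\,ab$ for $a,b\in G$, where $ab$ is the product in the group $G$. A 2-cochain is a map $F:G\times G\to k^*$ with $F(a,e)=F(e,a)=1$ for all $a$. An algebra is simple if its product is nonzero and it has no two-sided ideals other than $0$ and itself. *)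

theory Defs
  imports Complex_Main "HOL-Library.Poly_Mapping" "HOL-Library.Z2" "HOL-Library.Product_Plus"
begin

section \<open>Not necessarily associative algebras\<close>

locale nonassoc_algebra = vector_space scale
  for scale :: "'k::field \<Rightarrow> 'a::ab_group_add \<Rightarrow> 'a" +
  fixes mult :: "'a \<Rightarrow> 'a \<Rightarrow> 'a"
  assumes mult_add_left: "mult (u + v) w = mult u w + mult v w"
    and mult_add_right: "mult u (v + w) = mult u v + mult u w"
    and mult_scale_left: "mult (scale c u) v = scale c (mult u v)"
    and mult_scale_right: "mult u (scale c v) = scale c (mult u v)"

definition two_sided_ideal ::
    "('k::field \<Rightarrow> 'a::ab_group_add \<Rightarrow> 'a) \<Rightarrow> ('a \<Rightarrow> 'a \<Rightarrow> 'a) \<Rightarrow> 'a set \<Rightarrow> bool"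
  where "two_sided_ideal scale mult I \<longleftrightarrow>
    module.subspace scale I \<and> (\<forall>u. \<forall>v\<in>I. mult u v \<in> I \<and> mult v u \<in> I)"

definition simple_algebra ::
    "('k::field \<Rightarrow> 'a::ab_group_add \<Rightarrow> 'a) \<Rightarrow> ('a \<Rightarrow> 'a \<Rightarrow> 'a) \<Rightarrow> bool"
  where "simple_algebra scale mult \<longleftrightarrow>
    (\<exists>u v. mult u v \<noteq> 0) \<and>
    (\<forall>I. two_sided_ideal scale mult I \<longrightarrow> I = {0} \<or> I = UNIV)"


section \<open>Twisted group algebras\<close>

text \<open>
  The group \<open>G\<close> is written additively: \<open>0\<close> is its identity and \<open>a + b\<close> the product of
  \<open>a\<close> and \<open>b\<close>; it need not be commutative. The vector space with basis \<open>G\<close> is the type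
  \<open>'g \<Rightarrow>\<^sub>0 'k\<close> of finitely supported functions, the basis element \<open>a\<close> being
  \<open>Poly_Mapping.single a 1\<close>. The library's \<open>*\<close> on this type is the untwisted product and
  is not used.
\<close>

definition two_cochain :: "('g::group_add \<Rightarrow> 'g \<Rightarrow> 'k::field) \<Rightarrow> bool"
  where "two_cochain F \<longleftrightarrow>
    (\<forall>a b. F a b \<noteq> 0) \<and> (\<forall>a. F a 0 = 1 \<and> F 0 a = 1)"

definition tw_scale :: "'k::field \<Rightarrow> ('g \<Rightarrow>\<^sub>0 'k) \<Rightarrow> ('g \<Rightarrow>\<^sub>0 'k)"
  where "tw_scale c u = Poly_Mapping.map ((*) c) u"

text \<open>The bilinear extension of \<open>a \<cdot> b = F(a,b) ab\<close>; see \<open>tw_mult_single\<close> and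
  \<open>nonassoc_algebra_tw\<close> below.\<close>

definition tw_mult ::
    "('g::group_add \<Rightarrow> 'g \<Rightarrow> 'k::field) \<Rightarrow> ('g \<Rightarrow>\<^sub>0 'k) \<Rightarrow> ('g \<Rightarrow>\<^sub>0 'k) \<Rightarrow> ('g \<Rightarrow>\<^sub>0 'k)"
  where "tw_mult F u v =
    (\<Sum>a\<in>Poly_Mapping.keys u. \<Sum>b\<in>Poly_Mapping.keys v.
       Poly_Mapping.single (a + b)
         (Poly_Mapping.lookup u a * Poly_Mapping.lookup v b * F a b))"

lemma lookup_tw_scale [simp]:
  "Poly_Mapping.lookup (tw_scale c u) a = c * Poly_Mapping.lookup u a"
  by (simp add: tw_scale_def Poly_Mapping.map.rep_eq when_def)

lemma tw_scale_single [simp]: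
  "tw_scale c (Poly_Mapping.single a d) = Poly_Mapping.single a (c * d)"
  by (rule poly_mapping_eqI) (simp add: lookup_single when_def)

lemma tw_mult_superset:
  assumes "finite A" "finite B" "Poly_Mapping.keys u \<subseteq> A" "Poly_Mapping.keys v \<subseteq> B"
  shows "tw_mult F u v =
    (\<Sum>a\<in>A. \<Sum>b\<in>B. Poly_Mapping.single (a + b)
       (Poly_Mapping.lookup u a * Poly_Mapping.lookup v b * F a b))"
proof -
  have "tw_mult F u v = (\<Sum>a\<in>Poly_Mapping.keys u. \<Sum>b\<in>B. Poly_Mapping.single (a + b)
       (Poly_Mapping.lookup u a * Poly_Mapping.lookup v b * F a b))"
    unfolding tw_mult_def using assms
    by (intro sum.cong refl sum.mono_neutral_left) (auto simp: in_keys_iff)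
  also have "\<dots> = (\<Sum>a\<in>A. \<Sum>b\<in>B. Poly_Mapping.single (a + b)
       (Poly_Mapping.lookup u a * Poly_Mapping.lookup v b * F a b))"
    using assms by (intro sum.mono_neutral_left) (auto simp: in_keys_iff)
  finally show ?thesis .
qed

lemma tw_mult_single:
  "tw_mult F (Poly_Mapping.single a 1) (Poly_Mapping.single b 1) =
     tw_scale (F a b) (Poly_Mapping.single (a + b) 1)"
  by (simp add: tw_mult_def)

lemma vector_space_tw: "vector_space tw_scale"
  by unfold_locales (auto intro!: poly_mapping_eqI simp: lookup_add algebra_simps)

lemma tw_scale_sum: "tw_scale c (sum f A) = (\<Sum>a\<in>A. tw_scale c (f a))"
  by (rule poly_mapping_eqI) (simp add: lookup_sum sum_distrib_left)

lemma nonassoc_algebra_tw: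
  fixes F :: "'g::group_add \<Rightarrow> 'g \<Rightarrow> 'k::field"
  shows "nonassoc_algebra tw_scale (tw_mult F)"
proof -
  interpret vector_space "tw_scale :: 'k \<Rightarrow> ('g \<Rightarrow>\<^sub>0 'k) \<Rightarrow> _" by (rule vector_space_tw)
  show ?thesis
  proof
    fix u v w :: "'g \<Rightarrow>\<^sub>0 'k" and c :: 'k
    define K where
      "K = Poly_Mapping.keys u \<union> Poly_Mapping.keys v \<union> Poly_Mapping.keys w"
    have K: "finite K" "Poly_Mapping.keys u \<subseteq> K" "Poly_Mapping.keys v \<subseteq> K"
        "Poly_Mapping.keys w \<subseteq> K" "Poly_Mapping.keys (u + v) \<subseteq> K"
        "Poly_Mapping.keys (v + w) \<subseteq> K" "Poly_Mapping.keys (tw_scale c u) \<subseteq> K"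
        "Poly_Mapping.keys (tw_scale c v) \<subseteq> K"
      using keys_add[of u v] keys_add[of v w]
      by (auto simp: K_def in_keys_iff lookup_add)
    note expand = tw_mult_superset[OF K(1) K(1)]
    show "tw_mult F (u + v) w = tw_mult F u w + tw_mult F v w"
      by (simp add: expand K lookup_add algebra_simps single_add sum.distrib)
    show "tw_mult F u (v + w) = tw_mult F u v + tw_mult F u w"
      by (simp add: expand K lookup_add algebra_simps single_add sum.distrib)
    show "tw_mult F (tw_scale c u) v = tw_scale c (tw_mult F u v)"
      by (simp add: expand K tw_scale_sum algebra_simps)
    show "tw_mult F u (tw_scale c v) = tw_scale c (tw_mult F u v)"
      by (simp add: expand K tw_scale_sum algebra_simps)
  qed
qed


section \<open>The matrix\<close>

definition H_klein :: "'k::field list list"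
  where "H_klein =
    [[1,  1,  1,  1],
     [1,  1, -1, -1],
     [1, -1,  1, -1],
     [1, -1, -1,  1]]"

text \<open>Being a 2-cochain imposes nothing beyond the matrix entries.\<close>

lemma two_cochain_H_klein:
  fixes F :: "bit \<times> bit \<Rightarrow> bit \<times> bit \<Rightarrow> 'k::field"
  assumes G: "UNIV = {e, x, y, z}" "e = 0"
    and F: "\<forall>i<4. \<forall>j<4. F ([e, x, y, z] ! i) ([e, x, y, z] ! j) = H_klein ! i ! j"
  shows "two_cochain F"
proof -
  have idx: "\<exists>i<4. a = [e, x, y, z] ! i" for a
  proof -
    have "a \<in> set [e, x, y, z]" using G(1) by auto
    then obtain i where "i < length [e, x, y, z]" "[e, x, y, z] ! i = a"
      unfolding in_set_conv_nth by blast
    then show ?thesis by (intro exI[of _ i]) simp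
  qed
  have four: "i < 4 \<longleftrightarrow> i = 0 \<or> i = 1 \<or> i = 2 \<or> i = 3" for i :: nat by auto
  have nz: "F a b \<noteq> 0" for a b
  proof -
    obtain i j where "i < 4" "j < 4" "a = [e, x, y, z] ! i" "b = [e, x, y, z] ! j"
      using idx by metis
    moreover from this have "F a b = H_klein ! i ! j" using F by blast
    ultimately show ?thesis by (auto simp: four H_klein_def)
  qed
  have "F a 0 = 1 \<and> F 0 a = 1" for a
  proof -
    obtain i where i: "i < 4" "a = [e, x, y, z] ! i" using idx by metis
    have "F a e = H_klein ! i ! 0" "F e a = H_klein ! 0 ! i"
      using F[rule_format, of i 0] F[rule_format, of 0 i] i by simp_all
    then show ?thesis using i(1) G(2) by (auto simp: four H_klein_def)
  qed
  with nz show ?thesis by (auto simp: two_cochain_def)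
qed

end

theory Submission
  imports Defs
begin

text \<open>
  The signs of the matrix are those of a coboundary: with \<open>f e = 1\<close> and \<open>f x = f y = f z = -1\<close>
  one has \<open>F a b = f a * f b / f (a + b)\<close>. In other words, dividing the basis element of
  each \<open>a\<close> by \<open>f a\<close> turns \<open>k\<^sub>FG\<close> into the ordinary group algebra of an abelian group. Everything claimed
  follows from this one identity. A coboundary satisfies the cocycle condition, which gives
  associativity (\<open>tw_mult_assoc\<close>), and over an abelian group it is symmetric, which gives
  commutativity (\<open>tw_mult_commute\<close>). The augmentation of the group algebra, transported along
  the rescaling, is the linear functional \<open>a \<mapsto> f a\<close>; it is multiplicative, so its kernel is an
  ideal. It is proper because the functional does not vanish at the identity, and it
  is nonzero because the group has more than one element (\<open>coboundary_twist_not_simple\<close>).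
\<close>

section \<open>Twisted products with identities on the basis\<close>

lemma tw_mult_add_left: "tw_mult F (u + v) w = tw_mult F u w + tw_mult F v w"
  using nonassoc_algebra.mult_add_left[OF nonassoc_algebra_tw] .

lemma tw_mult_add_right: "tw_mult F u (v + w) = tw_mult F u v + tw_mult F u w"
  using nonassoc_algebra.mult_add_right[OF nonassoc_algebra_tw] .

lemma tw_mult_single_single:
  "tw_mult F (Poly_Mapping.single a c) (Poly_Mapping.single b d) =
     Poly_Mapping.single (a + b) (c * d * F a b)"
  by (subst tw_mult_superset[of "{a}" "{b}"]) auto

text \<open>This reduces identities between multilinear expressions to basis elements.\<close>

lemma poly_mapping_single_add_induct [case_names single add]:
  fixes u :: "'g \<Rightarrow>\<^sub>0 'k::comm_monoid_add"
  assumes single: "\<And>a c. P (Poly_Mapping.single a c)"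
    and add: "\<And>u v. P u \<Longrightarrow> P v \<Longrightarrow> P (u + v)"
  shows "P u"
proof (induction u rule: update_induct)
  case const
  show ?case using single[of undefined 0] by simp
next
  case (update u a c)
  have "Poly_Mapping.update a c u = u + Poly_Mapping.single a c"
    using update.hyps(1)
    by (intro poly_mapping_eqI) (auto simp: lookup_update lookup_add lookup_single in_keys_iff)
  then show ?case using update.IH single add by simp
qed

lemma tw_mult_assoc:
  fixes F :: "'g::group_add \<Rightarrow> 'g \<Rightarrow> 'k::field"
  assumes cocycle: "\<And>a b c. F a b * F (a + b) c = F b c * F a (b + c)"
  shows "tw_mult F (tw_mult F u v) w = tw_mult F u (tw_mult F v w)"
proof (induction u rule: poly_mapping_single_add_induct)
  case (single a p)
  show ?case
  proof (induction v rule: poly_mapping_single_add_induct)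
    case (single b q)
    show ?case
    proof (induction w rule: poly_mapping_single_add_induct)
      case (single c r)
      have "p * q * F a b * r * F (a + b) c = p * (q * r * F b c) * F a (b + c)"
        using cocycle[of a b c] by (simp add: algebra_simps)
      then show ?case by (simp only: tw_mult_single_single add.assoc)
    qed (simp add: tw_mult_add_right)
  qed (simp add: tw_mult_add_left tw_mult_add_right)
qed (simp add: tw_mult_add_left)

lemma tw_mult_commute:
  fixes F :: "'g::ab_group_add \<Rightarrow> 'g \<Rightarrow> 'k::field"
  assumes symmetric: "\<And>a b. F a b = F b a"
  shows "tw_mult F u v = tw_mult F v u"
proof (induction u rule: poly_mapping_single_add_induct)
  case (single a p)
  show ?case
  proof (induction v rule: poly_mapping_single_add_induct)
    case (single b q)
    show ?case
      using symmetric[of a b] by (simp add: tw_mult_single_single ac_simps)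
  qed (simp add: tw_mult_add_left tw_mult_add_right)
qed (simp add: tw_mult_add_left tw_mult_add_right)


section \<open>Coboundary twists\<close>

text \<open>
  Both sides of the cocycle condition, multiplied by \<open>f (a + b + c)\<close>, telescope to
  \<open>f a * f b * f c\<close>.
\<close>

lemma coboundary_imp_cocycle:
  fixes F :: "'g::group_add \<Rightarrow> 'g \<Rightarrow> 'k::field"
  assumes coboundary: "\<And>a b. F a b * f (a + b) = f a * f b"
    and nonzero: "\<And>a. f a \<noteq> 0"
  shows "F a b * F (a + b) c = F b c * F a (b + c)"
proof -
  have "F a b * F (a + b) c * f (a + b + c) = F a b * f (a + b) * f c"
    using coboundary[of "a + b" c] by (simp add: mult.assoc)
  also have "\<dots> = f a * (F b c * f (b + c))"
    by (simp add: coboundary mult.assoc)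
  also have "\<dots> = F b c * F a (b + c) * f (a + b + c)"
    using coboundary[of a "b + c"] by (simp add: ac_simps)
  finally show ?thesis using nonzero[of "a + b + c"] by simp
qed

definition linear_extension :: "('g \<Rightarrow> 'k::field) \<Rightarrow> ('g \<Rightarrow>\<^sub>0 'k) \<Rightarrow> 'k"
  where "linear_extension f u = (\<Sum>a\<in>Poly_Mapping.keys u. Poly_Mapping.lookup u a * f a)"

lemma linear_extension_superset:
  assumes "finite A" "Poly_Mapping.keys u \<subseteq> A"
  shows "linear_extension f u = (\<Sum>a\<in>A. Poly_Mapping.lookup u a * f a)"
  unfolding linear_extension_def using assms
  by (intro sum.mono_neutral_left) (auto simp: in_keys_iff)

lemma linear_extension_single [simp]:
  "linear_extension f (Poly_Mapping.single a c) = c * f a"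
  by (subst linear_extension_superset[of "{a}"]) auto

lemma linear_extension_zero [simp]: "linear_extension f 0 = 0"
  by (simp add: linear_extension_def)

lemma linear_extension_add [simp]:
  "linear_extension f (u + v) = linear_extension f u + linear_extension f v"
proof -
  let ?A = "Poly_Mapping.keys u \<union> Poly_Mapping.keys v"
  show ?thesis
    using keys_add[of u v]
    by (simp add: linear_extension_superset[of ?A] lookup_add distrib_right sum.distrib)
qed

lemma linear_extension_scale [simp]:
  "linear_extension f (tw_scale c u) = c * linear_extension f u"
proof -
  have "Poly_Mapping.keys (tw_scale c u) \<subseteq> Poly_Mapping.keys u"
    by (auto simp: in_keys_iff)
  then show ?thesis
    by (simp add: linear_extension_superset[of "Poly_Mapping.keys u"] sum_distrib_left mult.assoc)
qed

text \<open>
  The coboundary identity says exactly that \<open>f\<close> is multiplicative on products of basis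
  elements; bilinearity does the rest.
\<close>

lemma linear_extension_tw_mult:
  fixes F :: "'g::group_add \<Rightarrow> 'g \<Rightarrow> 'k::field"
  assumes coboundary: "\<And>a b. F a b * f (a + b) = f a * f b"
  shows "linear_extension f (tw_mult F u v) = linear_extension f u * linear_extension f v"
proof (induction u rule: poly_mapping_single_add_induct)
  case (single a p)
  show ?case
  proof (induction v rule: poly_mapping_single_add_induct)
    case (single b q)
    have "p * q * F a b * f (a + b) = p * f a * (q * f b)"
      using coboundary[of a b] by (simp add: algebra_simps)
    then show ?case by (simp add: tw_mult_single_single)
  qed (simp add: tw_mult_add_right distrib_left)
qed (simp add: tw_mult_add_left distrib_right)

text \<open>
  The kernel of a multiplicative functional is an ideal, and here it has codimension one in a
  space of dimension at least two, so it is neither everything nor zero.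
\<close>

lemma coboundary_twist_not_simple:
  fixes F :: "'g::group_add \<Rightarrow> 'g \<Rightarrow> 'k::field"
  assumes coboundary: "\<And>a b. F a b * f (a + b) = f a * f b"
    and nonzero: "\<And>a. f a \<noteq> 0"
    and nontrivial: "(g::'g) \<noteq> 0"
  shows "\<not> simple_algebra tw_scale (tw_mult F)"
proof
  assume simple: "simple_algebra tw_scale (tw_mult F)"
  interpret vector_space "tw_scale :: 'k \<Rightarrow> ('g \<Rightarrow>\<^sub>0 'k) \<Rightarrow> _" by (rule vector_space_tw)
  define I where "I = {u. linear_extension f u = 0}"
  have "two_sided_ideal tw_scale (tw_mult F) I"
    unfolding two_sided_ideal_def
    by (auto simp: I_def subspace_def linear_extension_tw_mult[of F f, OF coboundary])
  with simple have "I = {0} \<or> I = UNIV"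
    by (simp add: simple_algebra_def)
  moreover have "I \<noteq> UNIV"
  proof -
    have "Poly_Mapping.single 0 1 \<notin> I"
      using nonzero by (simp add: I_def del: single_one)
    then show ?thesis by blast
  qed
  moreover have "I \<noteq> {0}"
  proof -
    \<comment> \<open>The difference of the rescaled basis elements of \<open>0\<close> and \<open>g\<close>, with denominators cleared.\<close>
    define w where "w = Poly_Mapping.single 0 (f g) + Poly_Mapping.single g (- f 0)"
    have "w \<in> I" by (simp add: I_def w_def)
    moreover have "Poly_Mapping.lookup w 0 \<noteq> 0"
      using nonzero nontrivial by (simp add: w_def lookup_add lookup_single)
    then have "w \<noteq> 0" by auto
    ultimately show ?thesis by blast
  qed
  ultimately show False by blast
qed


section \<open>The Klein four-group\<close>

lemma klein_addition_table:
  fixes e x y z :: "bit \<times> bit"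
  assumes G: "UNIV = {e, x, y, z}" "e = 0" "z = x + y"
  shows "x \<noteq> 0" "y \<noteq> 0" "z \<noteq> 0"
    and "x + x = 0" "y + y = 0" "z + z = 0"
    and "y + x = z" "x + z = y" "z + x = y" "y + z = x" "z + y = x"
proof -
  have double: "a + a = 0" for a :: "bit \<times> bit"
    by (cases a) (simp add: zero_prod_def)
  then show "x + x = 0" "y + y = 0" "z + z = 0" by blast+
  have absorb: "a + (a + b) = b" for a b :: "bit \<times> bit"
    using double[of a] by (simp flip: add.assoc)
  show "y + x = z" "x + z = y" "z + x = y" "y + z = x" "z + y = x"
    using absorb[of x y] absorb[of y x] by (simp_all add: G(3) ac_simps)
  \<comment> \<open>The enumeration cannot repeat an element, as the group has four of them.\<close>
  have "(UNIV :: bit set) = {0, 1}"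
    using bit.exhaust by auto
  then have "card (UNIV :: bit set) = card {0, 1 :: bit}" by (rule arg_cong)
  then have "card (UNIV :: (bit \<times> bit) set) = 4"
    by (simp flip: UNIV_Times_UNIV add: card_cartesian_product)
  then have "card {e, x, y, z} = 4" using G(1) by simp
  then have "distinct [e, x, y, z]" by (intro card_distinct) simp
  then show "x \<noteq> 0" "y \<noteq> 0" "z \<noteq> 0" using G(2) by auto
qed

lemma klein_hadamard_coboundary:
  fixes F :: "bit \<times> bit \<Rightarrow> bit \<times> bit \<Rightarrow> 'k::field"
  assumes G: "UNIV = {e, x, y, z}" "e = 0" "z = x + y"
    and F: "\<forall>i<4. \<forall>j<4. F ([e, x, y, z] ! i) ([e, x, y, z] ! j) = H_klein ! i ! j"
  defines "f \<equiv> \<lambda>a. if a = 0 then 1 else - 1"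
  shows "F a b * f (a + b) = f a * f b"
proof -
  have idx: "\<exists>i<4. a = [e, x, y, z] ! i" for a
  proof -
    have "a \<in> set [e, x, y, z]" using G(1) by auto
    then obtain i where "i < length [e, x, y, z]" "[e, x, y, z] ! i = a"
      unfolding in_set_conv_nth by blast
    then show ?thesis by (intro exI[of _ i]) simp
  qed
  obtain i j where ij: "i < 4" "j < 4" "a = [e, x, y, z] ! i" "b = [e, x, y, z] ! j"
    using idx by metis
  have entry: "F a b = H_klein ! i ! j" using F ij by simp
  have four: "i < 4 \<longleftrightarrow> i = 0 \<or> i = 1 \<or> i = 2 \<or> i = 3" for i :: nat by auto
  note table = klein_addition_table[OF G]
  show ?thesis
    using ij(1,2) unfolding entry four unfolding ij(3,4)
    by (elim disjE) (simp_all add: f_def H_klein_def table G(2) G(3)[symmetric])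
qed

theorem proposition5p1:
  fixes F :: "bit \<times> bit \<Rightarrow> bit \<times> bit \<Rightarrow> 'k::field"
    and e x y z :: "bit \<times> bit"
  assumes "CHAR('k) \<noteq> 2"
    and "UNIV = {e, x, y, z}" and "e = 0" and "z = x + y"
    and "two_cochain F"
    and "\<forall>i<4. \<forall>j<4. F ([e, x, y, z] ! i) ([e, x, y, z] ! j) = H_klein ! i ! j"
  shows "\<not> simple_algebra tw_scale (tw_mult F)
    \<and> (\<forall>u v w. tw_mult F (tw_mult F u v) w = tw_mult F u (tw_mult F v w))
    \<and> (\<forall>u v. tw_mult F u v = tw_mult F v u)"
proof -
  define f :: "bit \<times> bit \<Rightarrow> 'k" where "f = (\<lambda>a. if a = 0 then 1 else - 1)"
  have coboundary: "F a b * f (a + b) = f a * f b" for a b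
    unfolding f_def by (rule klein_hadamard_coboundary[OF assms(2-4,6)])
  have nonzero: "f a \<noteq> 0" for a by (simp add: f_def)
  have symmetric: "F a b = F b a" for a b
    using coboundary[of a b] coboundary[of b a] nonzero[of "a + b"]
    by (simp add: ac_simps) (metis mult_right_cancel)
  show ?thesis
    using coboundary_twist_not_simple[OF coboundary nonzero klein_addition_table(1)[OF assms(2-4)]]
      tw_mult_assoc[OF coboundary_imp_cocycle[OF coboundary nonzero]]
      tw_mult_commute[of F, OF symmetric]
    by blast
qed

end
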